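(* The horizontal foliation on the bordered Prüfer surface $P$ admits a compatible Whitney flow, i.e. there is a flow $f\colon\mathbb{R}\times P\to P$ whose orbits are exactly the leaves of the horizontal foliation.
   Context: The bordered Prüfer surface $P$: as a set, $P=H\sqcup\bigsqcup_{x\in\mathbb{R}}R_x$, where $H=\mathbb{R}\times\mathbb{R}_{>0}$ and $R_x=\{r_{x,s}: s\in\mathbb{R}\}$, $r_{x,s}$ being thought of as the ray issuing from $(x,0)$ into $H$ with slope $s=\Delta x/\Delta y$. For each $x\in\mathbb{R}$ let $\varphi_x\colon\mathbb{R}\times[0,\infty)\to H\cup R_x$ be the bijection $\varphi_x(s,y)=(x+sy,y)$ for $y>0$ and $\varphi_x(s,0)=r_{x,s}$. The topology of $P$ is the one for which every $\varphi_x$ is a homeomorphism onto an open subset $H\cup R_x$ of $P$. Then $P$ is a Hausdorff non-metrizable $2$-manifold with boundary, with boundary components $R_x\cong\mathbb{R}$. The leaves of the horizontal foliation of $P$ are the lines $\mathbb{R}\times\{y\}\subset H$ for $y>0$, and the boundary components $R_x$ for $x\in\mathbb{R}$. A flow on $P$ is a continuous action $f\colon\mathbb{R}\times P\to P$ of the additive group $\mathbb{R}$; orbits are the sets $f(\mathbb{R}\times\{p\})$. *)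

theory Defs
  imports "HOL-Analysis.Analysis"
begin

section \<open>The bordered Pruefer surface\<close>

text \<open>\<open>Inner x y\<close> is the point \<open>(x, y)\<close> of the plane and \<open>Ray x s\<close> is the ray \<open>r\<^bsub>x,s\<^esub>\<close>.  The points
  \<open>Inner x y\<close> with \<open>y \<le> 0\<close> do not belong to the surface; they are excluded by the carrier set.\<close>

datatype prufer_point = Inner real real | Ray real real

definition prufer_H :: "prufer_point set" where
  "prufer_H = {Inner x y | x y. y > 0}"

definition prufer_R :: "real \<Rightarrow> prufer_point set" where
  "prufer_R x = range (Ray x)"

definition prufer_carrier :: "prufer_point set" where
  "prufer_carrier = prufer_H \<union> (\<Union>x. prufer_R x)"

definition closed_half_plane :: "(real \<times> real) set" where
  "closed_half_plane = UNIV \<times> {0..}"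

text \<open>The chart is only meaningful on the closed half plane.\<close>

definition prufer_chart :: "real \<Rightarrow> real \<times> real \<Rightarrow> prufer_point" where
  "prufer_chart x = (\<lambda>(s, y). if y > 0 then Inner (x + s * y) y else Ray x s)"

text \<open>The final topology of the charts.  Theorem \<open>prufer_topology_unique\<close> below shows that this is
  the one and only topology on the carrier for which every chart is a homeomorphism onto the open
  subset \<open>prufer_H \<union> prufer_R x\<close>.\<close>

definition prufer_topology :: "prufer_point topology" where
  "prufer_topology = topology (\<lambda>U. U \<subseteq> prufer_carrier \<and>
     (\<forall>x. openin (top_of_set closed_half_plane) {p \<in> closed_half_plane. prufer_chart x p \<in> U}))"

lemma openin_prufer_topology:
  "openin prufer_topology U \<longleftrightarrow> U \<subseteq> prufer_carrier \<and>
     (\<forall>x. openin (top_of_set closed_half_plane) {p \<in> closed_half_plane. prufer_chart x p \<in> U})"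
proof -
  let ?T = "\<lambda>U. U \<subseteq> prufer_carrier \<and>
     (\<forall>x. openin (top_of_set closed_half_plane) {p \<in> closed_half_plane. prufer_chart x p \<in> U})"
  have "istopology ?T"
    unfolding istopology_def
  proof (intro conjI allI impI)
    fix S T assume S: "?T S" and T: "?T T"
    show "S \<inter> T \<subseteq> prufer_carrier" using S by blast
    fix x
    have eq: "{p \<in> closed_half_plane. prufer_chart x p \<in> S \<inter> T} =
      {p \<in> closed_half_plane. prufer_chart x p \<in> S} \<inter> {p \<in> closed_half_plane. prufer_chart x p \<in> T}"
      by blast
    show "openin (top_of_set closed_half_plane)
        {p \<in> closed_half_plane. prufer_chart x p \<in> S \<inter> T}"
      unfolding eq by (rule openin_Int) (use S T in blast)+
  next
    fix K assume K: "\<forall>S\<in>K. ?T S"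
    show "\<Union>K \<subseteq> prufer_carrier" using K by blast
    fix x
    have eq: "{p \<in> closed_half_plane. prufer_chart x p \<in> \<Union>K} =
      (\<Union>S\<in>K. {p \<in> closed_half_plane. prufer_chart x p \<in> S})"
      by blast
    show "openin (top_of_set closed_half_plane)
        {p \<in> closed_half_plane. prufer_chart x p \<in> \<Union>K}"
      unfolding eq by (rule openin_Union) (use K in blast)
  qed
  then show ?thesis
    unfolding prufer_topology_def by (simp add: topology_inverse')
qed

lemma prufer_chart_image: "prufer_chart x ` closed_half_plane = prufer_H \<union> prufer_R x"
proof
  show "prufer_chart x ` closed_half_plane \<subseteq> prufer_H \<union> prufer_R x"
    by (auto simp: prufer_chart_def closed_half_plane_def prufer_H_def prufer_R_def)
  have "Inner a y \<in> prufer_chart x ` closed_half_plane" if "y > 0" for a y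
    by (rule image_eqI[of _ _ "((a - x) / y, y)"])
      (use that in \<open>auto simp: prufer_chart_def closed_half_plane_def\<close>)
  moreover have "Ray x s \<in> prufer_chart x ` closed_half_plane" for s
    by (rule image_eqI[of _ _ "(s, 0)"]) (auto simp: prufer_chart_def closed_half_plane_def)
  ultimately show "prufer_H \<union> prufer_R x \<subseteq> prufer_chart x ` closed_half_plane"
    by (auto simp: prufer_H_def prufer_R_def)
qed

lemma prufer_chart_inj: "inj_on (prufer_chart x) closed_half_plane"
  by (auto simp: inj_on_def prufer_chart_def closed_half_plane_def split: if_splits)

lemma topspace_prufer_topology: "topspace prufer_topology = prufer_carrier"
proof
  show "topspace prufer_topology \<subseteq> prufer_carrier"
    using openin_prufer_topology openin_topspace by blast
  have "{p \<in> closed_half_plane. prufer_chart x p \<in> prufer_carrier} = closed_half_plane" for x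
    using prufer_chart_image[of x] by (auto simp: prufer_carrier_def)
  then have "openin prufer_topology prufer_carrier"
    by (simp add: openin_prufer_topology)
  then show "prufer_carrier \<subseteq> topspace prufer_topology"
    by (rule openin_subset)
qed

lemma prufer_chart_open:
  assumes U: "openin (top_of_set closed_half_plane) U"
  shows "openin prufer_topology (prufer_chart x ` U)"
proof -
  have UH: "U \<subseteq> closed_half_plane" using U openin_imp_subset by blast
  have sub: "prufer_chart x ` U \<subseteq> prufer_carrier"
    using prufer_chart_image[of x] UH by (auto simp: prufer_carrier_def)
  moreover have "openin (top_of_set closed_half_plane)
      {p \<in> closed_half_plane. prufer_chart x' p \<in> prufer_chart x ` U}" for x'
  proof (cases "x' = x")
    case True
    have "{p \<in> closed_half_plane. prufer_chart x p \<in> prufer_chart x ` U} = U"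
      using prufer_chart_inj[of x] UH by (blast dest: inj_onD)
    then show ?thesis using U True by simp
  next
    case False
    obtain V where V: "open V" "U = closed_half_plane \<inter> V"
      using U by (auto simp: openin_open)
    let ?g = "\<lambda>p::real \<times> real. (fst p + (x' - x) / snd p, snd p)"
    let ?D = "{p::real \<times> real. snd p > 0}"
    have oD: "open ?D"
      by (intro open_Collect_less continuous_intros)
    have cont: "continuous_on ?D ?g"
      by (intro continuous_intros) auto
    have op: "open (?D \<inter> ?g -` V)"
      using continuous_open_preimage[OF cont oD V(1)] .
    have chart_eq: "prufer_chart x (?g p) = prufer_chart x' p" if "snd p > 0" for p
      using that by (auto simp: prufer_chart_def case_prod_beta field_simps)
    have "{p \<in> closed_half_plane. prufer_chart x' p \<in> prufer_chart x ` U}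
        = closed_half_plane \<inter> (?D \<inter> ?g -` V)"
    proof (rule set_eqI, rule iffI)
      fix p assume p: "p \<in> {p \<in> closed_half_plane. prufer_chart x' p \<in> prufer_chart x ` U}"
      then obtain q where q: "q \<in> U" "prufer_chart x' p = prufer_chart x q" by auto
      have pos: "snd p > 0"
        using q(2) False by (auto simp: prufer_chart_def case_prod_beta split: if_splits)
      have gp: "?g p \<in> closed_half_plane" using pos by (auto simp: closed_half_plane_def)
      have "?g p = q"
        proof (rule inj_onD[OF prufer_chart_inj _ gp])
        show "prufer_chart x (?g p) = prufer_chart x q" using chart_eq[OF pos] q(2) by (rule trans)
        show "q \<in> closed_half_plane" using q(1) UH by (rule rev_subsetD)
      qed
      then show "p \<in> closed_half_plane \<inter> (?D \<inter> ?g -` V)"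
        using p pos q V by auto
    next
      fix p assume p: "p \<in> closed_half_plane \<inter> (?D \<inter> ?g -` V)"
      then have pos: "snd p > 0" by auto
      have "?g p \<in> U" using p V by (auto simp: closed_half_plane_def)
      then have "prufer_chart x' p \<in> prufer_chart x ` U"
        unfolding chart_eq[OF pos, symmetric] by (rule imageI)
      then show "p \<in> {p \<in> closed_half_plane. prufer_chart x' p \<in> prufer_chart x ` U}"
        using p by auto
    qed
    then show ?thesis using openin_open_Int[OF op, of closed_half_plane] by (simp only:)
  qed
  ultimately show ?thesis by (simp add: openin_prufer_topology)
qed

lemma openin_prufer_chart_image: "openin prufer_topology (prufer_H \<union> prufer_R x)"
  using prufer_chart_open[of closed_half_plane x] by (simp add: prufer_chart_image)

lemma prufer_chart_homeomorphic_map: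
  "homeomorphic_map (top_of_set closed_half_plane)
     (subtopology prufer_topology (prufer_H \<union> prufer_R x)) (prufer_chart x)"
proof (rule bijective_open_imp_homeomorphic_map)
  have ts: "topspace (subtopology prufer_topology (prufer_H \<union> prufer_R x)) = prufer_H \<union> prufer_R x"
    using openin_subset[OF openin_prufer_chart_image[of x]] by auto
  have "continuous_map (top_of_set closed_half_plane) prufer_topology (prufer_chart x)"
    unfolding continuous_map_def
  proof (intro conjI allI impI)
    show "prufer_chart x \<in> topspace (top_of_set closed_half_plane) \<rightarrow> topspace prufer_topology"
      using prufer_chart_image[of x] by (auto simp: topspace_prufer_topology prufer_carrier_def)
    show "openin (top_of_set closed_half_plane)
        {p \<in> topspace (top_of_set closed_half_plane). prufer_chart x p \<in> U}"
      if "openin prufer_topology U" for U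
      using that by (simp add: openin_prufer_topology)
  qed
  then show "continuous_map (top_of_set closed_half_plane)
     (subtopology prufer_topology (prufer_H \<union> prufer_R x)) (prufer_chart x)"
    using prufer_chart_image[of x] by (auto simp: continuous_map_in_subtopology)
  show "open_map (top_of_set closed_half_plane)
     (subtopology prufer_topology (prufer_H \<union> prufer_R x)) (prufer_chart x)"
    unfolding open_map_def
  proof (intro allI impI)
    fix U assume U: "openin (top_of_set closed_half_plane) U"
    then have "U \<subseteq> closed_half_plane" using openin_imp_subset by blast
    then have "prufer_chart x ` U \<subseteq> prufer_H \<union> prufer_R x"
      using prufer_chart_image[of x] by blast
    then show "openin (subtopology prufer_topology (prufer_H \<union> prufer_R x)) (prufer_chart x ` U)"
      using prufer_chart_open[OF U] openin_prufer_chart_image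
      by (simp add: openin_open_subtopology)
  qed
  show "prufer_chart x ` topspace (top_of_set closed_half_plane)
      = topspace (subtopology prufer_topology (prufer_H \<union> prufer_R x))"
    using ts prufer_chart_image by simp
  show "inj_on (prufer_chart x) (topspace (top_of_set closed_half_plane))"
    using prufer_chart_inj by simp
qed

theorem prufer_topology_unique:
  "X = prufer_topology \<longleftrightarrow>
     topspace X = prufer_carrier \<and>
     (\<forall>x. openin X (prufer_H \<union> prufer_R x) \<and>
          homeomorphic_map (top_of_set closed_half_plane)
            (subtopology X (prufer_H \<union> prufer_R x)) (prufer_chart x))"
    (is "_ \<longleftrightarrow> ?R")
proof
  assume "X = prufer_topology"
  then show ?R
    using topspace_prufer_topology openin_prufer_chart_image prufer_chart_homeomorphic_map by simp
next
  assume R: ?R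
  have "openin X U \<longleftrightarrow> openin prufer_topology U" for U
  proof
    assume U: "openin X U"
    then have "U \<subseteq> prufer_carrier" using R openin_subset by blast
    moreover have "openin (top_of_set closed_half_plane)
        {p \<in> closed_half_plane. prufer_chart x p \<in> U}" for x
    proof -
      have "continuous_map (top_of_set closed_half_plane) X (prufer_chart x)"
        using R homeomorphic_imp_continuous_map continuous_map_in_subtopology by blast
      then show ?thesis
        using openin_continuous_map_preimage[OF _ U] by fastforce
    qed
    ultimately show "openin prufer_topology U" by (simp add: openin_prufer_topology)
  next
    assume U: "openin prufer_topology U"
    let ?A = "\<lambda>x. {p \<in> closed_half_plane. prufer_chart x p \<in> U}"
    have "openin X (prufer_chart x ` ?A x)" for x
    proof -
      have "openin (top_of_set closed_half_plane) (?A x)"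
        using U by (simp add: openin_prufer_topology)
      moreover have "open_map (top_of_set closed_half_plane)
          (subtopology X (prufer_H \<union> prufer_R x)) (prufer_chart x)"
        using R homeomorphic_imp_open_map by blast
      ultimately have "openin (subtopology X (prufer_H \<union> prufer_R x)) (prufer_chart x ` ?A x)"
        by (simp add: open_map_def)
      then show ?thesis
        using R by (meson openin_trans_full)
    qed
    then have "openin X (\<Union>x. prufer_chart x ` ?A x)" by blast
    moreover have "(\<Union>x. prufer_chart x ` ?A x) = U"
    proof
      show "(\<Union>x. prufer_chart x ` ?A x) \<subseteq> U" by blast
      show "U \<subseteq> (\<Union>x. prufer_chart x ` ?A x)"
      proof
        fix u assume u: "u \<in> U"
        then have "u \<in> prufer_carrier" using U by (auto simp: openin_prufer_topology)
        then obtain x where "u \<in> prufer_H \<union> prufer_R x" by (auto simp: prufer_carrier_def)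
        then obtain p where "p \<in> closed_half_plane" "u = prufer_chart x p"
          using prufer_chart_image[of x] by blast
        then show "u \<in> (\<Union>x. prufer_chart x ` ?A x)" using u by blast
      qed
    qed
    ultimately show "openin X U" by simp
  qed
  then show "X = prufer_topology" by (simp add: topology_eq)
qed

section \<open>Horizontal foliation and flows\<close>

text \<open>The foliation is given by its set of leaves.\<close>

definition prufer_horizontal_leaves :: "prufer_point set set" where
  "prufer_horizontal_leaves = {range (\<lambda>x. Inner x y) | y. y > 0} \<union> range prufer_R"

definition flow_on :: "'a topology \<Rightarrow> (real \<times> 'a \<Rightarrow> 'a) \<Rightarrow> bool" where
  "flow_on X f \<longleftrightarrow>
     continuous_map (prod_topology euclideanreal X) X f \<and>
     (\<forall>p \<in> topspace X. f (0, p) = p) \<and>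
     (\<forall>p \<in> topspace X. \<forall>s t. f (s + t, p) = f (s, f (t, p)))"

definition flow_orbit :: "(real \<times> 'a \<Rightarrow> 'a) \<Rightarrow> 'a \<Rightarrow> 'a set" where
  "flow_orbit f p = f ` (UNIV \<times> {p})"

end

(* Move each point (a, y) of H horizontally with velocity y. The chart at x gives that point the slope
   coordinate s = (a - x) / y, so in every chart the flow is the translation (s, y) \<mapsto> (s + t, y),
   which extends to the boundary lines as the translation of slopes. *)

theory Submission
  imports Defs
begin

text \<open>The case split is by constructor only, so points \<open>Inner a y\<close> with y \<le>
  0, outside the carrier, are moved too; the group laws then need no carrier hypothesis.\<close>

definition prufer_shear :: "real \<times> prufer_point \<Rightarrow> prufer_point" where
  "prufer_shear = (\<lambda>(t, p). case p of Inner a y \<Rightarrow> Inner (a + t * y) y | Ray x s \<Rightarrow> Ray x (s + t))"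

lemma prufer_shear_simps [simp]:
  "prufer_shear (t, Inner a y) = Inner (a + t * y) y"
  "prufer_shear (t, Ray x s) = Ray x (s + t)"
  by (simp_all add: prufer_shear_def)

text \<open>In H this is distributivity, (x + s y) + t y = x + (s + t) y; on the boundary the slope
  is shifted directly. Having one formula for both cases makes the flow continuous across
  \<open>prufer_R x\<close>.\<close>

lemma prufer_shear_chart:
  "prufer_shear (t, prufer_chart x (s, y)) = prufer_chart x (s + t, y)"
  by (simp add: prufer_chart_def algebra_simps)

lemma continuous_map_prufer_chart:
  "continuous_map (top_of_set closed_half_plane) prufer_topology (prufer_chart x)"
  using homeomorphic_imp_continuous_map[OF prufer_chart_homeomorphic_map]
  by (rule continuous_map_into_fulltopology)

lemma continuous_map_prufer_shear:
  "continuous_map (prod_topology euclideanreal prufer_topology) prufer_topology prufer_shear"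
\<comment> \<open>Continuity is local: the chart domains form an open cover, and every local piece
  is the same map, so agreement on overlaps is automatic.\<close>
proof (rule pasting_lemma[where I = UNIV and T = "\<lambda>x. UNIV \<times> (prufer_H \<union> prufer_R x)"
      and f = "\<lambda>_. prufer_shear"])
  fix x :: real
  let ?U = "prufer_H \<union> prufer_R x"
  show "openin (prod_topology euclideanreal prufer_topology) (UNIV \<times> ?U)"
    using openin_prufer_chart_image by (simp add: openin_prod_Times_iff)
  obtain \<psi> where hom: "homeomorphic_maps (top_of_set closed_half_plane)
      (subtopology prufer_topology ?U) (prufer_chart x) \<psi>"
    using prufer_chart_homeomorphic_map homeomorphic_map_maps by blast
  let ?X = "prod_topology euclideanreal (subtopology prufer_topology ?U)"
  \<comment> \<open>The flow read in the chart at x: \<open>\<psi>\<close> gives the coordinates of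
    the point, and the time is added to its slope.\<close>
  let ?g = "\<lambda>q. (fst (\<psi> (snd q)) + fst q, snd (\<psi> (snd q)))"
  have \<psi>: "continuous_map (subtopology prufer_topology ?U) (top_of_set closed_half_plane) \<psi>"
    and inv: "\<And>p. p \<in> topspace (subtopology prufer_topology ?U) \<Longrightarrow> prufer_chart x (\<psi> p) = p"
    using hom by (simp_all add: homeomorphic_maps_def)
  have \<psi>_snd: "continuous_map ?X (top_of_set closed_half_plane) (\<lambda>q. \<psi> (snd q))"
    using continuous_map_compose[OF continuous_map_snd \<psi>] by (simp add: o_def)
  \<comment> \<open>The half plane is not closed under arbitrary changes of coordinates, so
    continuity of \<open>?g\<close> is first shown into the whole plane.\<close>
  have \<psi>_euclidean: "continuous_map ?X (prod_topology euclideanreal euclideanreal) (\<lambda>q. \<psi> (snd q))"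
    using \<psi>_snd by (simp add: continuous_map_in_subtopology)
  have "continuous_map ?X (prod_topology euclideanreal euclideanreal) ?g"
    by (intro continuous_map_pairedI continuous_map_add continuous_map_fst
        continuous_map_fst_of[OF \<psi>_euclidean, unfolded o_def]
        continuous_map_snd_of[OF \<psi>_euclidean, unfolded o_def])
  \<comment> \<open>The translation keeps the second coordinate, so it preserves the half
    plane.\<close>
  moreover have "?g \<in> topspace ?X \<rightarrow> closed_half_plane"
    using continuous_map_funspace[OF \<psi>_snd] by (auto simp: closed_half_plane_def Pi_iff mem_Times_iff)
  ultimately have "continuous_map ?X (top_of_set closed_half_plane) ?g"
    by (simp add: continuous_map_in_subtopology)
  then have "continuous_map ?X prufer_topology (prufer_chart x \<circ> ?g)"
    using continuous_map_prufer_chart by (rule continuous_map_compose)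
  moreover have "(prufer_chart x \<circ> ?g) q = prufer_shear q" if "q \<in> topspace ?X" for q
  proof -
    have "prufer_chart x (\<psi> (snd q)) = snd q"
      using that by (intro inv) auto
    then show ?thesis
      using prufer_shear_chart[of "fst q" x "fst (\<psi> (snd q))" "snd (\<psi> (snd q))"] by simp
  qed
  ultimately have "continuous_map ?X prufer_topology prufer_shear"
    by (rule continuous_map_eq)
  then show "continuous_map (subtopology (prod_topology euclideanreal prufer_topology) (UNIV \<times> ?U))
      prufer_topology prufer_shear"
    by (simp add: subtopology_Times)
qed (auto simp: topspace_prufer_topology prufer_carrier_def)

lemma flow_on_prufer_shear: "flow_on prufer_topology prufer_shear"
  unfolding flow_on_def
proof (intro conjI ballI allI)
  show "continuous_map (prod_topology euclideanreal prufer_topology) prufer_topology prufer_shear"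
    by (rule continuous_map_prufer_shear)
  fix p
  show "prufer_shear (0, p) = p"
    by (cases p) auto
  \<comment> \<open>The height, and hence the velocity, is constant along an orbit, so displacements
    add up.\<close>
  show "prufer_shear (s + t, p) = prufer_shear (s, prufer_shear (t, p))" for s t
    by (cases p) (auto simp: algebra_simps)
qed

lemma flow_orbit_prufer_shear_Inner:
  assumes "y > 0"
  shows "flow_orbit prufer_shear (Inner a y) = range (\<lambda>x. Inner x y)"
proof
  show "flow_orbit prufer_shear (Inner a y) \<subseteq> range (\<lambda>x. Inner x y)"
    by (auto simp: flow_orbit_def)
  \<comment> \<open>The distance x - a is covered at velocity y \<noteq> 0 in time (x - a) /
    y.\<close>
  have "Inner x y \<in> flow_orbit prufer_shear (Inner a y)" for x
    unfolding flow_orbit_def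
    by (rule image_eqI[where x = "((x - a) / y, Inner a y)"]) (use assms in simp_all)
  then show "range (\<lambda>x. Inner x y) \<subseteq> flow_orbit prufer_shear (Inner a y)"
    by blast
qed

lemma flow_orbit_prufer_shear_Ray: "flow_orbit prufer_shear (Ray x s) = prufer_R x"
proof
  show "flow_orbit prufer_shear (Ray x s) \<subseteq> prufer_R x"
    by (auto simp: flow_orbit_def prufer_R_def)
  have "Ray x r \<in> flow_orbit prufer_shear (Ray x s)" for r
    unfolding flow_orbit_def
    by (rule image_eqI[where x = "(r - s, Ray x s)"]) simp_all
  then show "prufer_R x \<subseteq> flow_orbit prufer_shear (Ray x s)"
    by (auto simp: prufer_R_def)
qed

theorem proposition3p5:
  shows "\<exists>f. flow_on prufer_topology f \<and>
           flow_orbit f ` topspace prufer_topology = prufer_horizontal_leaves"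
proof (intro exI conjI)
  show "flow_on prufer_topology prufer_shear"
    by (rule flow_on_prufer_shear)
  have "flow_orbit prufer_shear ` prufer_H = {range (\<lambda>x. Inner x y) | y. y > 0}"
  proof (intro set_eqI iffI)
    fix L assume "L \<in> {range (\<lambda>x. Inner x y) | y. y > 0}"
    \<comment> \<open>Any point at height y represents the leaf; \<open>Inner 0 y\<close> is
      chosen.\<close>
    then obtain y where "y > 0" "L = flow_orbit prufer_shear (Inner 0 y)"
      using flow_orbit_prufer_shear_Inner by auto
    then show "L \<in> flow_orbit prufer_shear ` prufer_H"
      by (auto simp: prufer_H_def)
  qed (auto simp: prufer_H_def flow_orbit_prufer_shear_Inner)
  moreover have "flow_orbit prufer_shear ` (\<Union>x. prufer_R x) = range prufer_R"
  proof -
    \<comment> \<open>\<open>flow_orbit prufer_shear\<close> is constant on the nonempty set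
      \<open>prufer_R x\<close>, so its image there is a singleton.\<close>
    have "flow_orbit prufer_shear ` prufer_R x = {prufer_R x}" for x
      by (simp add: image_image flow_orbit_prufer_shear_Ray prufer_R_def[of x])
    then show ?thesis
      by (simp add: image_UN UNION_singleton_eq_range)
  qed
  ultimately show "flow_orbit prufer_shear ` topspace prufer_topology = prufer_horizontal_leaves"
    by (simp add: topspace_prufer_topology prufer_carrier_def prufer_horizontal_leaves_def image_Un)
qed

end
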